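(* Let $G$ be a subgroup of R. Thompson's group $V$, and let $T$ be any countable virtually free group. Then the restricted wreath product $G\wr T$ embeds as a subgroup of $V$.
   Context: Let $\mathfrak{C}_2 := \{0,1\}^\omega$ be the Cantor space of infinite binary strings with the product topology. A barrier is a finite set $\mathcal{B}\subset\{0,1\}^\ast$ of finite strings such that every element of $\{0,1\}^\omega$ has a unique string in $\mathcal{B}$ as a prefix. Given barriers $\mathcal{D},\mathcal{R}$ and a bijection $\sigma:\mathcal{D}\to\mathcal{R}$, the induced prefix replacement map is the map $\mathfrak{C}_2\to\mathfrak{C}_2$ sending $d\hat{x}\mapsto d^\sigma\hat{x}$ for all $d\in\mathcal{D}$, $\hat{x}\in\{0,1\}^\omega$. R. Thompson's group $V$ is the group of all prefix replacement maps of $\mathfrak{C}_2$ under composition. A group is virtually free if it contains a free group (possibly trivial) as a subgroup of finite index. The restricted wreath product $G\wr T$ with top group $T$ is the semidirect product $\left(\bigoplus_{t\in T}G\right)\rtimes T$, where $T$ permutes the coordinates of the direct sum by its regular action on itself. *)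

theory Defs
  imports "HOL-Algebra.Algebra" "HOL-Library.Stream" "HOL-Library.Countable_Set"
begin

text \<open>
  The Cantor space is the type \<^typ>\<open>bool stream\<close>, finite binary strings are
  \<^typ>\<open>bool list\<close>, and \<^term>\<open>w @- x\<close> is the concatenation of a finite and an
  infinite string.
\<close>

definition barrier :: "bool list set \<Rightarrow> bool" where
  "barrier B \<longleftrightarrow> finite B \<and> (\<forall>s :: bool stream. \<exists>!w. w \<in> B \<and> (\<exists>x. s = w @- x))"

definition prefix_replacement_map :: "(bool stream \<Rightarrow> bool stream) \<Rightarrow> bool" where
  "prefix_replacement_map f \<longleftrightarrow>
     (\<exists>D R \<sigma>. barrier D \<and> barrier R \<and> bij_betw \<sigma> D R \<and>
        (\<forall>d \<in> D. \<forall>x. f (d @- x) = \<sigma> d @- x))"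

definition thompson_V :: "(bool stream \<Rightarrow> bool stream) monoid" where
  "thompson_V = \<lparr>carrier = Collect prefix_replacement_map, monoid.mult = (\<circ>), one = id\<rparr>"

text \<open>
  A letter \<open>(s, True)\<close> stands for the element \<open>s\<close> and \<open>(s, False)\<close> for its inverse.
  A group is free if it has a subset \<open>S\<close> (a free basis) such that each element is the
  value of exactly one reduced word over \<open>S\<close>.  The empty basis gives the trivial group.
\<close>

definition letter_value :: "('a, 'c) monoid_scheme \<Rightarrow> 'a \<times> bool \<Rightarrow> 'a" where
  "letter_value F l = (if snd l then fst l else inv\<^bsub>F\<^esub> (fst l))"

definition word_value :: "('a, 'c) monoid_scheme \<Rightarrow> ('a \<times> bool) list \<Rightarrow> 'a" where
  "word_value F w = foldr (\<lambda>l x. letter_value F l \<otimes>\<^bsub>F\<^esub> x) w \<one>\<^bsub>F\<^esub>"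

definition reduced_words :: "'a set \<Rightarrow> ('a \<times> bool) list set" where
  "reduced_words S =
     {w \<in> lists (S \<times> UNIV). successively (\<lambda>(s, b) (t, c). s = t \<longrightarrow> b = c) w}"

definition free_group :: "('a, 'c) monoid_scheme \<Rightarrow> bool" where
  "free_group F \<longleftrightarrow> group F \<and>
     (\<exists>S \<subseteq> carrier F. bij_betw (word_value F) (reduced_words S) (carrier F))"

definition virtually_free :: "('a, 'c) monoid_scheme \<Rightarrow> bool" where
  "virtually_free T \<longleftrightarrow>
     (\<exists>H. subgroup H T \<and> free_group (T\<lparr>carrier := H\<rparr>) \<and> finite (rcosets\<^bsub>T\<^esub> H))"

definition semidirect_product ::
  "('a, 'c) monoid_scheme \<Rightarrow> ('b, 'd) monoid_scheme \<Rightarrow> ('b \<Rightarrow> 'a \<Rightarrow> 'a) \<Rightarrow> ('a \<times> 'b) monoid" where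
  "semidirect_product N H \<alpha> =
     \<lparr>carrier = carrier N \<times> carrier H,
      monoid.mult = (\<lambda>(n, h) (m, k). (n \<otimes>\<^bsub>N\<^esub> \<alpha> h m, h \<otimes>\<^bsub>H\<^esub> k)),
      one = (\<one>\<^bsub>N\<^esub>, \<one>\<^bsub>H\<^esub>)\<rparr>"

text \<open>
  \<open>t\<close> moves the entry at coordinate \<open>u\<close> to coordinate \<open>t u\<close>, whence the inverse below.
  Families indexed by \<^term>\<open>carrier T\<close> are \<^const>\<open>undefined\<close> outside it.
\<close>

definition regular_shift ::
  "('b, 'd) monoid_scheme \<Rightarrow> 'b \<Rightarrow> ('b \<Rightarrow> 'a) \<Rightarrow> ('b \<Rightarrow> 'a)" where
  "regular_shift T t f = (\<lambda>x \<in> carrier T. f (inv\<^bsub>T\<^esub> t \<otimes>\<^bsub>T\<^esub> x))"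

definition wreath_product ::
  "('a, 'c) monoid_scheme \<Rightarrow> ('b, 'd) monoid_scheme \<Rightarrow> (('b \<Rightarrow> 'a) \<times> 'b) monoid" where
  "wreath_product G T =
     semidirect_product (sum_group (carrier T) (\<lambda>_. G)) T (regular_shift T)"

end

theory Submission
  imports Defs
begin

text \<open>
  Suppose that \<open>T\<close> acts by elements of \<open>V\<close> in such a way that some cylinder \<open>U\<close> meets none of its
  translates \<open>t U\<close> with \<open>t \<noteq> 1\<close>.  A copy of \<open>G\<close> acting on \<open>U\<close> alone and its conjugates on the
  translates then commute, and together with \<open>T\<close> they generate \<open>G \<wr> T\<close>.  A free group on countably
  many letters has such an action by ping-pong.  If \<open>H\<close> has finite index in \<open>T\<close>, the action of
  \<open>H\<close> induces one of \<open>T\<close> on \<open>T/H\<close> copies of the Cantor space, which a barrier with as many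
  words as cosets identifies with the Cantor space.
\<close>

section \<open>Local characterisation of prefix replacement maps\<close>

text \<open>Membership in V is mostly checked without naming two barriers: a bijection belongs to V
  once finitely many cylinders cover the space and each is moved by a change of prefix. The obstacle
  is that an infinite T has infinitely many translates, while an element of V is described by
  finitely many cylinders; the finite supports in the restricted product resolve this, since only
  finitely many conjugates are composed. Ping-pong here needs infinitely many disjoint pairs of
  zones and a cylinder outside all of them, which nonempty reduced words push into a zone. The zones
  110 and 10 of \<open>pong\<close> and the spare cylinder 111 partition cylinder 1, and
  \<open>drift\<close> carries cylinder 1 to infinitely many disjoint places, so conjugates of one
  map suffice. Inducing keeps a wandering cylinder because t returns the cell of the coset H to
  itself only if t lies in H, where wandering is already known.\<close>

abbreviation cylinder :: "bool list \<Rightarrow> bool stream set" where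
  "cylinder w \<equiv> range ((@-) w)"

text \<open>HOL-Algebra takes over the notation for the inverse function.\<close>
abbreviation inverse_map :: "('a \<Rightarrow> 'b) \<Rightarrow> 'b \<Rightarrow> 'a" where
  "inverse_map \<equiv> inv_into UNIV"

section \<open>Barriers and the sizes they can have\<close>

lemma barrier_cover:
  assumes "barrier B"
  obtains w x where "w \<in> B" "s = w @- x"
  using assms unfolding barrier_def by blast

lemma barrier_unique:
  assumes "barrier B" "w \<in> B" "w' \<in> B" "w @- x = w' @- x'"
  shows "w = w' \<and> x = x'"
proof -
  have "w = w'" using assms unfolding barrier_def by metis
  then show ?thesis using assms by simp
qed

lemma barrier_singleton: "barrier {[]}"
  by (auto simp: barrier_def)

lemma barrier_caret:
  assumes "barrier B"
  shows "barrier (insert [True] ((#) False ` B))"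
  unfolding barrier_def
proof (intro conjI allI)
  show "finite (insert [True] ((#) False ` B))" using assms by (simp add: barrier_def)
next
  fix s :: "bool stream"
  obtain b t where s: "s = b ## t" by (cases s)
  obtain w x where w: "w \<in> B" "t = w @- x" using barrier_cover[OF assms] .
  show "\<exists>!v. v \<in> insert [True] ((#) False ` B) \<and> (\<exists>x. s = v @- x)"
  proof (cases b)
    case True
    show ?thesis
      by (rule ex1I[of _ "[True]"]) (use True s in auto)
  next
    case False
    show ?thesis
    proof (rule ex1I[of _ "False # w"])
      fix v assume "v \<in> insert [True] ((#) False ` B) \<and> (\<exists>x. s = v @- x)"
      then obtain w' x' where "w' \<in> B" "v = False # w'" "w' @- x' = w @- x"
        using False s w by auto
      then show "v = False # w" using w barrier_unique[OF assms] by blast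
    qed (use False s w in auto)
  qed
qed

text \<open>Hanging a barrier below \<open>False\<close> and adding the word \<open>[True]\<close>
  raises its size by one. The cosets of a subgroup of finite index will be matched with the words of
  such a barrier.\<close>

lemma barrier_card_ex: "\<exists>B. barrier B \<and> card B = Suc n"
proof (induction n)
  case 0
  show ?case using barrier_singleton by (intro exI[of _ "{[]}"]) simp
next
  case (Suc n)
  then obtain B where B: "barrier B" "card B = Suc n" by blast
  then have "card (insert [True] ((#) False ` B)) = Suc (Suc n)"
    by (subst card_insert_disjoint) (auto simp: barrier_def card_image)
  then show ?case using barrier_caret[OF B(1)] by blast
qed

lemma finite_words: "finite {w :: bool list. length w = n}"
  using finite_lists_length_eq[of "UNIV :: bool set" n] by simp

lemma shift_eq_shift_length:
  assumes "w @- x = w' @- x'" "length w \<le> length w'"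
  obtains v where "w' = w @ v" "x = v @- x'"
proof -
  have "take (length w) w' = w"
    using assms stake_shift[of "length w" w x] stake_shift[of "length w" w' x'] by simp
  then have "w' = w @ drop (length w) w'" by (metis append_take_drop_id)
  moreover from this have "x = drop (length w) w' @- x'"
    using assms(1) by (metis shift_append shift_left_inj)
  ultimately show ?thesis using that by blast
qed

lemma barrier_length: "barrier {w. length w = n}"
  unfolding barrier_def
proof (intro conjI finite_words allI)
  fix s :: "bool stream"
  show "\<exists>!w. w \<in> {w. length w = n} \<and> (\<exists>x. s = w @- x)"
  proof (rule ex1I[of _ "stake n s"])
    show "stake n s \<in> {w. length w = n} \<and> (\<exists>x. s = stake n s @- x)"
      by (metis (mono_tags) length_stake mem_Collect_eq stake_sdrop)
  qed (auto simp: stake_shift)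
qed

lemma cylinder_cover_length: "\<exists>d\<in>{w. length w = n}. s \<in> cylinder d"
proof (rule bexI[of _ "stake n s"])
  show "s \<in> cylinder (stake n s)" by (rule range_eqI[of _ _ "sdrop n s"]) (simp add: stake_sdrop)
qed simp

text \<open>The target barrier is the image of \<open>D\<close> under \<open>\<sigma>\<close>:
  injectivity of \<open>f\<close> keeps its cylinders disjoint, and surjectivity makes them
  cover.\<close>

lemma prefix_replacement_map_barrier_image:
  assumes "bij f" "barrier D" and loc: "\<And>d x. d \<in> D \<Longrightarrow> f (d @- x) = \<sigma> d @- x"
  shows "prefix_replacement_map f"
  unfolding prefix_replacement_map_def
proof (intro exI conjI ballI allI)
  have eq: "d = d'" if "d \<in> D" "d' \<in> D" "\<sigma> d @- x = \<sigma> d' @- x'" for d d' x x'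
  proof -
    have "f (d @- x) = f (d' @- x')" using that loc by simp
    then have "d @- x = d' @- x'" using \<open>bij f\<close> by (simp add: bij_is_inj inj_eq)
    then show ?thesis using barrier_unique[OF assms(2)] that by blast
  qed
  show "bij_betw \<sigma> D (\<sigma> ` D)"
    by (intro bij_betw_imageI inj_onI) (use eq in auto)
  show "barrier (\<sigma> ` D)"
    unfolding barrier_def
  proof (intro conjI allI)
    show "finite (\<sigma> ` D)" using assms(2) by (simp add: barrier_def)
    fix s
    obtain t where t: "s = f t" using \<open>bij f\<close> by (meson bij_pointE)
    obtain d x where d: "d \<in> D" "t = d @- x" using barrier_cover[OF assms(2)] .
    then have s: "s = \<sigma> d @- x" using t loc by simp
    show "\<exists>!w. w \<in> \<sigma> ` D \<and> (\<exists>x. s = w @- x)"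
      by (rule ex1I[of _ "\<sigma> d"]) (use d s eq in auto)
  qed
qed (use assms in auto)

text \<open>The cylinders may overlap. Cutting every stream at a length \<open>N\<close> that no
  word of \<open>D\<close> exceeds gives a barrier, each word of which extends some word of
  \<open>D\<close>.\<close>

lemma prefix_replacement_mapI:
  assumes "bij f" "finite D" and cover: "\<And>s. \<exists>d\<in>D. s \<in> cylinder d"
    and loc: "\<And>d. d \<in> D \<Longrightarrow> \<exists>r. \<forall>x. f (d @- x) = r @- x"
  shows "prefix_replacement_map f"
proof -
  obtain N where N: "\<And>d. d \<in> D \<Longrightarrow> length d \<le> N"
    using finite_imageI[OF \<open>finite D\<close>, of length] by (meson finite_nat_set_iff_bounded_le imageI)
  have "\<exists>v. \<forall>x. f (w @- x) = v @- x" if w: "w \<in> {w. length w = N}" for w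
  proof -
    \<comment> \<open>The tail \<open>undefined\<close> is arbitrary: one point of the cylinder of
      \<open>w\<close> is enough to find a \<open>d\<close> which, being no longer than
      \<open>w\<close>, is a prefix of it.\<close>
    obtain d y where d: "d \<in> D" "w @- undefined = d @- y" using cover by blast
    moreover have "length d \<le> length w" using N w d by simp
    ultimately obtain v where v: "w = d @ v" by (metis shift_eq_shift_length)
    obtain r where "\<forall>x. f (d @- x) = r @- x" using loc d by blast
    then have "\<forall>x. f (w @- x) = (r @ v) @- x" using v by simp
    then show ?thesis by blast
  qed
  then obtain \<sigma> where "\<And>w x. w \<in> {w. length w = N} \<Longrightarrow> f (w @- x) = \<sigma> w @- x" by metis
  then show ?thesis by (rule prefix_replacement_map_barrier_image[OF assms(1) barrier_length])
qed

lemma prefix_replacement_map_bij: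
  assumes "prefix_replacement_map f"
  shows "bij f"
proof -
  obtain D R \<sigma> where D: "barrier D" and R: "barrier R" and \<sigma>: "bij_betw \<sigma> D R"
    and f: "\<And>d x. d \<in> D \<Longrightarrow> f (d @- x) = \<sigma> d @- x"
    using assms unfolding prefix_replacement_map_def by blast
  show ?thesis
  proof (rule bijI)
    show "inj f"
    proof (rule injI)
      fix s t assume eq: "f s = f t"
      obtain d x where d: "d \<in> D" "s = d @- x" using barrier_cover[OF D] .
      obtain e y where e: "e \<in> D" "t = e @- y" using barrier_cover[OF D] .
      have "\<sigma> d @- x = \<sigma> e @- y" using eq d e f by simp
      moreover have "\<sigma> d \<in> R" "\<sigma> e \<in> R" using \<sigma> d e by (auto simp: bij_betw_def)
      ultimately have "\<sigma> d = \<sigma> e \<and> x = y" by (intro barrier_unique[OF R])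
      then show "s = t" using \<sigma> d e by (auto simp: bij_betw_def inj_on_def)
    qed
    show "surj f"
    proof (unfold surj_def, rule allI)
      fix s
      obtain r x where "r \<in> R" "s = r @- x" using barrier_cover[OF R] .
      moreover obtain d where "d \<in> D" "\<sigma> d = r"
        using \<open>r \<in> R\<close> \<sigma> unfolding bij_betw_def by blast
      ultimately show "\<exists>t. s = f t" using f by (intro exI[of _ "d @- x"]) simp
    qed
  qed
qed

text \<open>A uniform converse of \<open>prefix_replacement_mapI\<close>: a word at least as long as
  all words of the domain barrier extends one of them.\<close>

lemma prefix_replacement_map_local:
  assumes "prefix_replacement_map f"
  shows "\<exists>N. \<forall>w. N \<le> length w \<longrightarrow> (\<exists>v. \<forall>x. f (w @- x) = v @- x)"
proof -
  obtain D \<sigma> where D: "barrier D" and f: "\<And>d x. d \<in> D \<Longrightarrow> f (d @- x) = \<sigma> d @- x"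
    using assms unfolding prefix_replacement_map_def by blast
  have "finite D" using D by (simp add: barrier_def)
  then obtain N where N: "\<And>d. d \<in> D \<Longrightarrow> length d \<le> N"
    by (meson finite_imageI finite_nat_set_iff_bounded_le imageI)
  have "\<exists>v. \<forall>x. f (w @- x) = v @- x" if w: "N \<le> length w" for w
  proof -
    obtain d y where d: "d \<in> D" "w @- undefined = d @- y" using barrier_cover[OF D] .
    moreover have "length d \<le> length w" using N[OF d(1)] w by simp
    ultimately obtain v where v: "w = d @ v" by (metis shift_eq_shift_length)
    then have "\<forall>x. f (w @- x) = (\<sigma> d @ v) @- x" using f d by simp
    then show ?thesis by blast
  qed
  then show ?thesis by blast
qed

lemma prefix_replacement_map_id: "prefix_replacement_map id"
  by (rule prefix_replacement_mapI[of _ "{[]}"]) (auto intro: exI[of _ "[]"])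

lemma prefix_replacement_map_comp:
  assumes "prefix_replacement_map f" "prefix_replacement_map g"
  shows "prefix_replacement_map (f \<circ> g)"
proof -
  obtain M where M: "\<And>w. M \<le> length w \<Longrightarrow> \<exists>v. \<forall>x. f (w @- x) = v @- x"
    using prefix_replacement_map_local[OF assms(1)] by blast
  obtain N where N: "\<And>w. N \<le> length w \<Longrightarrow> \<exists>v. \<forall>x. g (w @- x) = v @- x"
    using prefix_replacement_map_local[OF assms(2)] by blast
  show ?thesis
  proof (rule prefix_replacement_mapI[OF _ finite_words[of "N + M"]])
    show "bij (f \<circ> g)" using assms prefix_replacement_map_bij bij_comp by blast
    show "\<exists>d\<in>{w. length w = N + M}. s \<in> cylinder d" for s
      by (rule cylinder_cover_length)
  next
    fix w :: "bool list" assume "w \<in> {w. length w = N + M}"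
    then have l: "length w = N + M" by simp
    \<comment> \<open>\<open>g\<close> rewrites only the first \<open>N\<close> letters, so the last
      \<open>M\<close> survive and the new prefix is long enough for \<open>f\<close>.\<close>
    obtain v where v: "\<forall>x. g (take N w @- x) = v @- x" using N[of "take N w"] l by auto
    obtain v' where v': "\<forall>x. f ((v @ drop N w) @- x) = v' @- x"
      using M[of "v @ drop N w"] l by auto
    have "(f \<circ> g) (w @- x) = v' @- x" for x
    proof -
      have "g (w @- x) = (v @ drop N w) @- x"
        using v by (metis append_take_drop_id shift_append)
      then show ?thesis using v' by simp
    qed
    then show "\<exists>r. \<forall>x. (f \<circ> g) (w @- x) = r @- x" by blast
  qed
qed

lemma prefix_replacement_map_inv:
  assumes "prefix_replacement_map f"
  shows "prefix_replacement_map (inverse_map f)"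
proof -
  obtain D R \<sigma> where D: "barrier D" and R: "barrier R" and \<sigma>: "bij_betw \<sigma> D R"
    and f: "\<And>d x. d \<in> D \<Longrightarrow> f (d @- x) = \<sigma> d @- x"
    using assms unfolding prefix_replacement_map_def by blast
  have "inverse_map f (r @- x) = inv_into D \<sigma> r @- x" if "r \<in> R" for r x
  proof -
    have "inv_into D \<sigma> r \<in> D" "\<sigma> (inv_into D \<sigma> r) = r"
      using that \<sigma> by (auto simp: bij_betw_def inv_into_into f_inv_into_f)
    then have "f (inv_into D \<sigma> r @- x) = r @- x" using f by simp
    then show ?thesis
      using prefix_replacement_map_bij[OF assms] by (intro inv_f_eq) (simp_all add: bij_is_inj)
  qed
  then show ?thesis
    unfolding prefix_replacement_map_def
    by (intro exI[of _ R] exI[of _ D] exI[of _ "inv_into D \<sigma>"])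
      (simp add: D R bij_betw_inv_into[OF \<sigma>])
qed

lemma prefix_replacement_map_funpow:
  "prefix_replacement_map f \<Longrightarrow> prefix_replacement_map (f ^^ n)"
  by (induction n) (auto intro: prefix_replacement_map_comp prefix_replacement_map_id simp: id_def[symmetric])

lemma thompson_V_simps [simp]:
  "f \<in> carrier thompson_V \<longleftrightarrow> prefix_replacement_map f"
  "f \<otimes>\<^bsub>thompson_V\<^esub> g = f \<circ> g"
  "\<one>\<^bsub>thompson_V\<^esub> = id"
  by (simp_all add: thompson_V_def)

lemma group_thompson_V: "group thompson_V"
proof (rule groupI)
  fix f assume "f \<in> carrier thompson_V"
  then have "prefix_replacement_map f" by simp
  then show "\<exists>g\<in>carrier thompson_V. g \<otimes>\<^bsub>thompson_V\<^esub> f = \<one>\<^bsub>thompson_V\<^esub>"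
    using prefix_replacement_map_inv prefix_replacement_map_bij
    by (intro bexI[of _ "inverse_map f"]) (auto simp: bij_is_inj)
qed (auto intro: prefix_replacement_map_comp prefix_replacement_map_id)

lemma inv_thompson_V:
  assumes "prefix_replacement_map f"
  shows "inv\<^bsub>thompson_V\<^esub> f = inverse_map f"
  using assms prefix_replacement_map_inv prefix_replacement_map_bij
  by (intro group.inv_equality[OF group_thompson_V]) (auto simp: bij_is_inj)

section \<open>Gluing maps along a barrier\<close>

text \<open>Made for induced actions, where a group element permutes the cosets, seen as cells of a
  barrier, and acts inside each cell through the subgroup. A bound \<open>M\<close> common to the
  finitely many \<open>g i\<close> supplies the cylinders.\<close>

lemma prefix_replacement_map_glue:
  assumes "barrier B" "bij_betw c I B" "bij_betw \<pi> I I"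
    and g: "\<And>i. i \<in> I \<Longrightarrow> prefix_replacement_map (g i)"
  shows "\<exists>f. prefix_replacement_map f \<and> (\<forall>i\<in>I. \<forall>x. f (c i @- x) = c (\<pi> i) @- g i x)"
proof -
  have "finite I" using assms(1,2) bij_betw_finite by (auto simp: barrier_def)
  have cB: "c i \<in> B" if "i \<in> I" for i using assms(2) that by (auto simp: bij_betw_def)
  have \<pi>I: "\<pi> i \<in> I" if "i \<in> I" for i using assms(3) that by (auto simp: bij_betw_def)
  have dec: "\<exists>i\<in>I. \<exists>x. s = c i @- x" for s
    using barrier_cover[OF assms(1), of s] assms(2) by (metis bij_betw_iff_bijections)
  have uniq: "i = j \<and> x = y" if "i \<in> I" "j \<in> I" "c i @- x = c j @- y" for i j x y
    using barrier_unique[OF assms(1) cB cB] assms(2) that by (metis bij_betw_inv_into_left)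
  obtain idx rest where decompose: "\<And>s. idx s \<in> I \<and> s = c (idx s) @- rest s" using dec by metis
  define f where "f s = c (\<pi> (idx s)) @- g (idx s) (rest s)" for s
  have f: "f (c i @- x) = c (\<pi> i) @- g i x" if "i \<in> I" for i x
  proof -
    have "idx (c i @- x) = i \<and> rest (c i @- x) = x" using decompose[of "c i @- x"] uniq that by metis
    then show ?thesis by (simp add: f_def)
  qed
  have "bij f"
  proof (rule bijI)
    show "inj f"
    proof (rule injI)
      fix s t assume eq: "f s = f t"
      obtain i x where i: "i \<in> I" "s = c i @- x" using dec by blast
      obtain j y where j: "j \<in> I" "t = c j @- y" using dec by blast
      have *: "\<pi> i = \<pi> j \<and> g i x = g j y" using eq i j f uniq \<pi>I by metis
      then have "i = j" using assms(3) i j by (metis bij_betw_inv_into_left)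
      moreover have "x = y" using * \<open>i = j\<close> prefix_replacement_map_bij[OF g[OF i(1)]]
        by (simp add: bij_is_inj inj_eq)
      ultimately show "s = t" using i j by simp
    qed
    show "surj f"
    proof (unfold surj_def, rule allI)
      fix s
      obtain j y where j: "j \<in> I" "s = c j @- y" using dec by blast
      obtain i where i: "i \<in> I" "\<pi> i = j" using assms(3) j by (metis bij_betw_iff_bijections)
      obtain x where "g i x = y" using prefix_replacement_map_bij[OF g[OF i(1)]] by (metis bij_pointE)
      then show "\<exists>t. s = f t" using f i j by metis
    qed
  qed
  obtain N where N: "\<And>i w. i \<in> I \<Longrightarrow> N i \<le> length w \<Longrightarrow> \<exists>v. \<forall>x. g i (w @- x) = v @- x"
    using prefix_replacement_map_local[OF g] by metis
  obtain M where M: "\<And>i. i \<in> I \<Longrightarrow> N i \<le> M"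
    using \<open>finite I\<close> by (meson finite_imageI finite_nat_set_iff_bounded_le imageI)
  have "prefix_replacement_map f"
  proof (rule prefix_replacement_mapI[OF \<open>bij f\<close>])
    let ?D = "\<Union>i\<in>I. (@) (c i) ` {w. length w = M}"
    show "finite ?D" using \<open>finite I\<close> finite_words by blast
    show "\<exists>d\<in>?D. s \<in> cylinder d" for s
    proof -
      obtain i x where i: "i \<in> I" "s = c i @- x" using dec by blast
      obtain w y where w: "w \<in> {w. length w = M}" "x = w @- y"
        using barrier_cover[OF barrier_length] .
      show ?thesis by (rule bexI[of _ "c i @ w"]) (use i w in auto)
    qed
    show "\<exists>r. \<forall>x. f (d @- x) = r @- x" if d: "d \<in> ?D" for d
    proof -
      obtain i w where i: "i \<in> I" "length w = M" "d = c i @ w" using d by auto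
      then obtain v where "\<forall>x. g i (w @- x) = v @- x" using N M by metis
      then have "\<forall>x. f (d @- x) = (c (\<pi> i) @ v) @- x" using i f by simp
      then show ?thesis by blast
    qed
  qed
  then show ?thesis using f by blast
qed

section \<open>A map transplanted to a single cylinder\<close>

definition act_on_cylinder :: "bool list \<Rightarrow> (bool stream \<Rightarrow> bool stream) \<Rightarrow> bool stream \<Rightarrow> bool stream" where
  "act_on_cylinder u g z = (if z \<in> cylinder u then u @- g (sdrop (length u) z) else z)"

lemma act_on_cylinder_shift [simp]: "act_on_cylinder u g (u @- x) = u @- g x"
  by (simp add: act_on_cylinder_def sdrop_shift)

lemma act_on_cylinder_outside [simp]: "z \<notin> cylinder u \<Longrightarrow> act_on_cylinder u g z = z"
  by (simp add: act_on_cylinder_def)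

text \<open>A word of length \<open>length u + N\<close> either extends \<open>u\<close>, and then
  \<open>g\<close> rewrites its remainder, or its cylinder is disjoint from that of
  \<open>u\<close>.\<close>

lemma prefix_replacement_map_act_on_cylinder:
  assumes "prefix_replacement_map g"
  shows "prefix_replacement_map (act_on_cylinder u g)"
proof -
  obtain N where N: "\<And>w. N \<le> length w \<Longrightarrow> \<exists>v. \<forall>x. g (w @- x) = v @- x"
    using prefix_replacement_map_local[OF assms] by blast
  have inverse: "act_on_cylinder u h (act_on_cylinder u k z) = z" if "h \<circ> k = id" for h k z
    using that by (cases "z \<in> cylinder u") (auto simp: fun_eq_iff)
  show ?thesis
  proof (rule prefix_replacement_mapI[OF _ finite_words[of "length u + N"]])
    have "inverse_map g \<circ> g = id" "g \<circ> inverse_map g = id"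
      using prefix_replacement_map_bij[OF assms] by (auto simp: bij_def surj_iff)
    then have "act_on_cylinder u (inverse_map g) \<circ> act_on_cylinder u g = id"
        "act_on_cylinder u g \<circ> act_on_cylinder u (inverse_map g) = id"
      by (intro ext; simp add: inverse)+
    then show "bij (act_on_cylinder u g)" by (rule o_bij)
    show "\<exists>d\<in>{w. length w = length u + N}. s \<in> cylinder d" for s
      by (rule cylinder_cover_length)
  next
    fix w :: "bool list" assume "w \<in> {w. length w = length u + N}"
    then have l: "length w = length u + N" by simp
    show "\<exists>r. \<forall>x. act_on_cylinder u g (w @- x) = r @- x"
    proof (cases "take (length u) w = u")
      case True
      then obtain w' where w: "w = u @ w'" by (metis append_take_drop_id)
      then obtain v where "\<forall>x. g (w' @- x) = v @- x" using N[of w'] l by auto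
      then have "\<forall>x. act_on_cylinder u g (w @- x) = (u @ v) @- x" using w by simp
      then show ?thesis by blast
    next
      case False
      have "w @- x \<notin> cylinder u" for x
      proof
        assume "w @- x \<in> cylinder u"
        then obtain y where "u @- y = w @- x" by force
        then obtain v where "w = u @ v" using shift_eq_shift_length[of u y w x] l by auto
        then show False using False by simp
      qed
      then show ?thesis by (intro exI[of _ w]) simp
    qed
  qed
qed

section \<open>Wreath products from wandering cylinders\<close>

locale wandering_action = group T for T (structure) +
  fixes \<rho> :: "'a \<Rightarrow> bool stream \<Rightarrow> bool stream" and u :: "bool list"
  assumes hom: "\<rho> \<in> hom T thompson_V"
    and wandering: "t \<in> carrier T \<Longrightarrow> \<rho> t (u @- x) = u @- y \<Longrightarrow> t = \<one>"
begin

lemma prefix_replacement_map_action: "t \<in> carrier T \<Longrightarrow> prefix_replacement_map (\<rho> t)"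
  using hom by (auto simp: hom_def)

lemma action_mult: "s \<in> carrier T \<Longrightarrow> t \<in> carrier T \<Longrightarrow> \<rho> (s \<otimes> t) = \<rho> s \<circ> \<rho> t"
  using hom by (auto simp: hom_def)

lemma action_one: "\<rho> \<one> = id"
  using hom_one[OF hom is_group group_thompson_V] by simp

lemma action_inv_cancel:
  assumes "t \<in> carrier T"
  shows "\<rho> (inv t) (\<rho> t z) = z" "\<rho> t (\<rho> (inv t) z) = z"
  using action_mult[of "inv t" t] action_mult[of t "inv t"] assms
  by (simp_all add: action_one fun_eq_iff)

lemma translates_disjoint:
  assumes "s \<in> carrier T" "t \<in> carrier T" "\<rho> s (u @- x) = \<rho> t (u @- y)"
  shows "s = t \<and> x = y"
proof -
  have "\<rho> (inv s \<otimes> t) (u @- y) = u @- x"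
    using assms action_mult[of "inv s" t] action_inv_cancel(1)[of s "u @- x"] by simp
  then have "inv s \<otimes> t = \<one>" using wandering assms by blast
  then have "s = t" using assms by (metis inv_equality inv_inv inv_closed)
  then show ?thesis
    using assms action_inv_cancel(1)[of s "u @- x"] action_inv_cancel(1)[of s "u @- y"] by auto
qed

section \<open>The base group acting on the translates\<close>

definition translates :: "bool stream set" where
  "translates = (\<Union>t\<in>carrier T. \<rho> t ` cylinder u)"

lemma translates_cases:
  obtains (inside) t x where "t \<in> carrier T" "z = \<rho> t (u @- x)" | (outside) "z \<notin> translates"
  by (auto simp: translates_def)

lemma action_translates_iff:
  assumes "s \<in> carrier T"
  shows "\<rho> s z \<in> translates \<longleftrightarrow> z \<in> translates"
proof -
  have *: "\<rho> t z \<in> translates" if t: "t \<in> carrier T" and z: "z \<in> translates" for t z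
  proof -
    obtain a x where a: "a \<in> carrier T" "z = \<rho> a (u @- x)"
      using z by (auto simp: translates_def)
    then have "\<rho> t z = \<rho> (t \<otimes> a) (u @- x)" using t by (simp add: action_mult)
    then show ?thesis using t a(1) by (auto simp: translates_def)
  qed
  then show ?thesis using assms action_inv_cancel(1) by (metis inv_closed)
qed

text \<open>The family \<open>f\<close> acts on the translate \<open>\<rho> t (cylinder u)\<close> by the conjugate of \<open>f t\<close>.\<close>

definition base_action :: "('a \<Rightarrow> bool stream \<Rightarrow> bool stream) \<Rightarrow> bool stream \<Rightarrow> bool stream" where
  "base_action f z =
     (if z \<in> translates
      then (let t = (SOME t. t \<in> carrier T \<and> z \<in> \<rho> t ` cylinder u)
            in \<rho> t (act_on_cylinder u (f t) (\<rho> (inv t) z)))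
      else z)"

lemma base_action_inside [simp]:
  assumes "t \<in> carrier T"
  shows "base_action f (\<rho> t (u @- x)) = \<rho> t (u @- f t x)"
proof -
  let ?P = "\<lambda>s. s \<in> carrier T \<and> \<rho> t (u @- x) \<in> \<rho> s ` cylinder u"
  have "?P t" using assms by blast
  \<comment> \<open>Disjointness of the translates leaves \<open>SOME\<close> no choice.\<close>
  moreover have "s = t" if "?P s" for s using that assms translates_disjoint by blast
  ultimately have "(SOME s. ?P s) = t" by (metis (no_types, lifting) someI)
  moreover have "\<rho> t (u @- x) \<in> translates" using assms by (auto simp: translates_def)
  ultimately show ?thesis by (simp add: base_action_def Let_def action_inv_cancel assms)
qed

lemma base_action_outside [simp]: "z \<notin> translates \<Longrightarrow> base_action f z = z"
  by (simp add: base_action_def)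

lemma base_action_mult:
  "base_action (\<lambda>t\<in>carrier T. f t \<circ> g t) = base_action f \<circ> base_action g"
proof (rule ext)
  fix z show "base_action (\<lambda>t\<in>carrier T. f t \<circ> g t) z = (base_action f \<circ> base_action g) z"
    by (cases z rule: translates_cases) auto
qed

lemma base_action_trivial:
  assumes "\<And>t. t \<in> carrier T \<Longrightarrow> f t = id"
  shows "base_action f = id"
proof (rule ext)
  fix z show "base_action f z = id z"
    by (cases z rule: translates_cases) (auto simp: assms)
qed

text \<open>This is the semidirect product relation: \<open>\<rho> s\<close> carries translate
  \<open>t\<close> to translate \<open>s \<otimes> t\<close>, where the shifted family has the entry
  \<open>f t\<close> because \<open>inv s \<otimes> (s \<otimes> t) = t\<close>.\<close>

lemma base_action_shift:
  assumes "s \<in> carrier T"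
  shows "base_action (regular_shift T s f) \<circ> \<rho> s = \<rho> s \<circ> base_action f"
proof (rule ext)
  fix z show "(base_action (regular_shift T s f) \<circ> \<rho> s) z = (\<rho> s \<circ> base_action f) z"
  proof (cases z rule: translates_cases)
    case (inside t x)
    have [simp]: "\<rho> s (\<rho> t y) = \<rho> (s \<otimes> t) y" for y using inside assms by (simp add: action_mult)
    show ?thesis using inside assms by (simp add: regular_shift_def inv_solve_left' m_assoc[symmetric])
  next
    case outside
    then show ?thesis using assms by (simp add: action_translates_iff)
  qed
qed

text \<open>Coordinates of the finite support are split off one at a time, each contributing a
  conjugate of a map on the cylinder of \<open>u\<close>. The induction runs over a finite set
  \<open>S\<close> containing the support, so that erasing the entry at \<open>a\<close> leads to a
  smaller set.\<close>

lemma prefix_replacement_map_base_action: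
  assumes "finite {t \<in> carrier T. f t \<noteq> id}"
    and "\<And>t. t \<in> carrier T \<Longrightarrow> prefix_replacement_map (f t)"
  shows "prefix_replacement_map (base_action f)"
proof -
  have "prefix_replacement_map (base_action f)"
    if "finite S" "{t \<in> carrier T. f t \<noteq> id} \<subseteq> S"
      "\<And>t. t \<in> carrier T \<Longrightarrow> prefix_replacement_map (f t)" for S f
    using that
  proof (induction S arbitrary: f)
    case empty
    then have "base_action f = id" by (intro base_action_trivial) auto
    then show ?case using prefix_replacement_map_id by (simp only:)
  next
    case (insert a S)
    show ?case
    proof (cases "a \<in> carrier T")
      case False
      then show ?thesis using insert.prems by (intro insert.IH) auto
    next
      case True
      \<comment> \<open>\<open>?g\<close> is the contribution of coordinate \<open>a\<close> alone,
        \<open>?f\<close> the family without it.\<close>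
      let ?f = "f(a := id)" and ?g = "\<rho> a \<circ> act_on_cylinder u (f a) \<circ> \<rho> (inv a)"
      have not_in: "\<rho> (inv a) z \<notin> cylinder u" if "z \<notin> \<rho> a ` cylinder u" for z
        using that action_inv_cancel(2)[OF True, of z] by (metis imageI)
      have "base_action f = base_action ?f \<circ> ?g"
      proof (rule ext)
        fix z show "base_action f z = (base_action ?f \<circ> ?g) z"
        proof (cases z rule: translates_cases)
          case (inside t x)
          show ?thesis
          proof (cases "t = a")
            case True
            then show ?thesis using inside by (simp add: action_inv_cancel)
          next
            case False
            then have "z \<notin> \<rho> a ` cylinder u" using inside True translates_disjoint by blast
            then have "?g z = z" using not_in True by (simp add: action_inv_cancel)
            then have "(base_action ?f \<circ> ?g) z = base_action ?f z" by (metis comp_apply)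
            then show ?thesis using inside False by simp
          qed
        next
          case outside
          then have "z \<notin> \<rho> a ` cylinder u" using True by (auto simp: translates_def)
          then have "?g z = z" using not_in True by (simp add: action_inv_cancel)
          then have "(base_action ?f \<circ> ?g) z = base_action ?f z" by (metis comp_apply)
          then show ?thesis using outside by simp
        qed
      qed
      moreover have "prefix_replacement_map (base_action ?f)"
        using insert.prems by (intro insert.IH) (auto simp: prefix_replacement_map_id)
      moreover have "prefix_replacement_map ?g"
        using True insert.prems
        by (intro prefix_replacement_map_comp prefix_replacement_map_act_on_cylinder
            prefix_replacement_map_action) auto
      ultimately show ?thesis using prefix_replacement_map_comp by metis
    qed
  qed
  then show ?thesis using assms by blast
qed

section \<open>The faithful action of the wreath product\<close>

definition wreath_action ::
    "('a \<Rightarrow> bool stream \<Rightarrow> bool stream) \<times> 'a \<Rightarrow> bool stream \<Rightarrow> bool stream" where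
  "wreath_action = (\<lambda>(f, t). base_action f \<circ> \<rho> t)"

context
  fixes G assumes G: "subgroup G thompson_V"
begin

abbreviation "wr \<equiv> wreath_product (thompson_V\<lparr>carrier := G\<rparr>) T"

lemma carrier_wreath:
  "carrier wr = {f \<in> carrier T \<rightarrow>\<^sub>E G. finite {t \<in> carrier T. f t \<noteq> id}} \<times> carrier T"
  using subgroup.subgroup_is_group[OF G group_thompson_V]
  by (simp add: wreath_product_def semidirect_product_def carrier_sum_group)

lemma mult_wreath:
  "(f, s) \<otimes>\<^bsub>wr\<^esub> (g, t) = (\<lambda>x\<in>carrier T. f x \<circ> regular_shift T s g x, s \<otimes> t)"
  by (simp add: wreath_product_def semidirect_product_def)

text \<open>The support of the shifted family lies in the translate by \<open>s\<close> of the
  support of \<open>f\<close>, hence is finite.\<close>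

lemma regular_shift_closed:
  assumes "(f, t) \<in> carrier wr" "s \<in> carrier T"
  shows "(regular_shift T s f, t) \<in> carrier wr"
proof -
  have "{x \<in> carrier T. regular_shift T s f x \<noteq> id} \<subseteq> (\<otimes>) s ` {x \<in> carrier T. f x \<noteq> id}"
  proof
    fix x assume x: "x \<in> {x \<in> carrier T. regular_shift T s f x \<noteq> id}"
    then have "x = s \<otimes> (inv s \<otimes> x)" using assms(2) by (simp add: m_assoc[symmetric])
    then show "x \<in> (\<otimes>) s ` {x \<in> carrier T. f x \<noteq> id}"
      using x assms(2) by (intro image_eqI) (auto simp: regular_shift_def)
  qed
  then have "finite {x \<in> carrier T. regular_shift T s f x \<noteq> id}"
    using assms by (auto simp: carrier_wreath intro: finite_surj)
  then show ?thesis
    using assms by (auto simp: carrier_wreath regular_shift_def PiE_iff)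
qed

lemma mult_wreath_closed:
  assumes "a \<in> carrier wr" "b \<in> carrier wr"
  shows "a \<otimes>\<^bsub>wr\<^esub> b \<in> carrier wr"
proof -
  obtain f s g t where [simp]: "a = (f, s)" "b = (g, t)" by fastforce
  have s: "s \<in> carrier T" "t \<in> carrier T" using assms by (auto simp: carrier_wreath)
  let ?g = "regular_shift T s g"
  have g: "(?g, t) \<in> carrier wr" using regular_shift_closed assms s by simp
  have "{x \<in> carrier T. f x \<circ> ?g x \<noteq> id} \<subseteq>
      {x \<in> carrier T. f x \<noteq> id} \<union> {x \<in> carrier T. ?g x \<noteq> id}" by auto
  then have "finite {x \<in> carrier T. f x \<circ> ?g x \<noteq> id}"
    using assms g by (auto simp: carrier_wreath intro: finite_subset)
  moreover have "f x \<circ> ?g x \<in> G" if "x \<in> carrier T" for x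
    using subgroup.m_closed[OF G, of "f x" "?g x"] assms g that by (auto simp: carrier_wreath)
  ultimately show ?thesis
    using s by (auto simp: mult_wreath carrier_wreath cong: conj_cong)
qed

lemma prefix_replacement_map_wreath_action:
  assumes "a \<in> carrier wr"
  shows "prefix_replacement_map (wreath_action a)"
proof -
  obtain f t where a: "a = (f, t)" by fastforce
  have "prefix_replacement_map (f x)" if "x \<in> carrier T" for x
    using that assms a subgroup.mem_carrier[OF G] by (auto simp: carrier_wreath)
  then show ?thesis
    using assms a by (auto simp: wreath_action_def carrier_wreath
        intro!: prefix_replacement_map_comp prefix_replacement_map_base_action
          prefix_replacement_map_action)
qed

lemma wreath_action_mult:
  assumes "a \<in> carrier wr" "b \<in> carrier wr"
  shows "wreath_action (a \<otimes>\<^bsub>wr\<^esub> b) = wreath_action a \<circ> wreath_action b"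
proof -
  obtain f s g t where [simp]: "a = (f, s)" "b = (g, t)" by fastforce
  have s: "s \<in> carrier T" "t \<in> carrier T" using assms by (auto simp: carrier_wreath)
  have "wreath_action (a \<otimes>\<^bsub>wr\<^esub> b) = base_action f \<circ> (base_action (regular_shift T s g) \<circ> \<rho> s) \<circ> \<rho> t"
    using s by (simp add: wreath_action_def mult_wreath base_action_mult action_mult comp_assoc)
  also have "\<dots> = wreath_action a \<circ> wreath_action b"
    using s by (simp only: base_action_shift) (simp add: wreath_action_def comp_assoc)
  finally show ?thesis .
qed

text \<open>\<open>base_action\<close> keeps every translate in place, so the image of the cylinder
  of \<open>u\<close> lies in translate \<open>s\<close> and reveals \<open>s\<close>. The points
  that \<open>\<rho> t\<close> brings to translate \<open>x\<close> then reveal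
  \<open>f x\<close>.\<close>

lemma inj_on_wreath_action: "inj_on wreath_action (carrier wr)"
proof (rule inj_onI)
  fix a b assume ab: "a \<in> carrier wr" "b \<in> carrier wr" and eq: "wreath_action a = wreath_action b"
  obtain f s g t where [simp]: "a = (f, s)" "b = (g, t)" by fastforce
  have s: "s \<in> carrier T" "t \<in> carrier T" using ab by (auto simp: carrier_wreath)
  have "wreath_action a (u @- undefined) = wreath_action b (u @- undefined)" using eq by simp
  then have "\<rho> s (u @- f s undefined) = \<rho> t (u @- g t undefined)"
    using s by (simp add: wreath_action_def)
  then have [simp]: "s = t" using translates_disjoint s by blast
  have "f x = g x" for x
  proof (cases "x \<in> carrier T")
    case True
    show ?thesis
    proof (rule ext)
      fix z
      have "wreath_action a (\<rho> (inv t) (\<rho> x (u @- z))) = wreath_action b (\<rho> (inv t) (\<rho> x (u @- z)))"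
        using eq by simp
      then have "\<rho> x (u @- f x z) = \<rho> x (u @- g x z)"
        using s True by (simp add: wreath_action_def action_inv_cancel)
      then show "f x z = g x z" using translates_disjoint True by blast
    qed
  next
    case False
    then show ?thesis using ab by (auto simp: carrier_wreath PiE_iff extensional_def)
  qed
  then show "a = b" by auto
qed

text \<open>The witness is the semidirect product inverse: the pointwise inverses of
  \<open>f\<close>, shifted by \<open>inv t\<close>, with \<open>inv t\<close>. It is verified on
  the maps, which gives closure of the image under inverses without the group axioms of
  \<open>wr\<close>.\<close>

lemma left_inverse_wreath_action:
  assumes "a \<in> carrier wr"
  shows "\<exists>b\<in>carrier wr. wreath_action b \<circ> wreath_action a = id"
proof -
  obtain f t where [simp]: "a = (f, t)" by fastforce
  let ?f = "\<lambda>x\<in>carrier T. inverse_map (f x)"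
  have f: "f x \<in> G" if "x \<in> carrier T" for x
    using assms that by (auto simp: carrier_wreath)
  have t: "t \<in> carrier T" using assms by (auto simp: carrier_wreath)
  have V: "prefix_replacement_map (f x)" if "x \<in> carrier T" for x
    using subgroup.mem_carrier[OF G f[OF that]] by simp
  have inv_G: "inverse_map (f x) \<in> G" if "x \<in> carrier T" for x
    using subgroup.m_inv_closed[OF G f[OF that]] V[OF that] by (simp add: inv_thompson_V)
  have "{x \<in> carrier T. ?f x \<noteq> id} \<subseteq> {x \<in> carrier T. f x \<noteq> id}"
    by (auto simp: inv_id)
  moreover have "finite {x \<in> carrier T. f x \<noteq> id}" using assms by (auto simp: carrier_wreath)
  ultimately have "finite {x \<in> carrier T. ?f x \<noteq> id}" by (rule finite_subset)
  then have f': "(?f, inv t) \<in> carrier wr" using t inv_G by (auto simp: carrier_wreath)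
  let ?b = "(regular_shift T (inv t) ?f, inv t)"
  have "base_action ?f \<circ> base_action f = base_action (\<lambda>x\<in>carrier T. ?f x \<circ> f x)"
    by (rule base_action_mult[symmetric])
  also have "\<dots> = id"
    using V prefix_replacement_map_bij by (intro base_action_trivial) (auto simp: bij_is_inj)
  finally have cancel: "base_action ?f \<circ> base_action f = id" .
  have "wreath_action ?b \<circ> wreath_action a =
      (base_action (regular_shift T (inv t) ?f) \<circ> \<rho> (inv t)) \<circ> (base_action f \<circ> \<rho> t)"
    by (simp add: wreath_action_def)
  also have "\<dots> = \<rho> (inv t) \<circ> (base_action ?f \<circ> base_action f) \<circ> \<rho> t"
    using t by (simp only: base_action_shift inv_closed comp_assoc)
  also have "\<dots> = id"
    using t by (simp only: cancel) (simp add: fun_eq_iff action_inv_cancel)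
  finally show ?thesis using regular_shift_closed[OF f'] t by blast
qed

lemma wreath_product_embeds:
  "\<exists>H. subgroup H thompson_V \<and> wr \<cong> thompson_V\<lparr>carrier := H\<rparr>"
proof (intro exI conjI)
  let ?H = "wreath_action ` carrier wr"
  show "subgroup ?H thompson_V"
  proof (rule group.subgroupI[OF group_thompson_V])
    show "?H \<subseteq> carrier thompson_V" using prefix_replacement_map_wreath_action by auto
    have "(\<lambda>x\<in>carrier T. id, \<one>) \<in> carrier wr"
      using subgroup.one_closed[OF G] by (auto simp: carrier_wreath)
    then show "?H \<noteq> {}" by blast
  next
    fix p assume "p \<in> ?H"
    then obtain a where a: "a \<in> carrier wr" "p = wreath_action a" by blast
    obtain b where b: "b \<in> carrier wr" "wreath_action b \<circ> wreath_action a = id"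
      using left_inverse_wreath_action[OF a(1)] by blast
    have "inv\<^bsub>thompson_V\<^esub> p = wreath_action b"
      using a b prefix_replacement_map_wreath_action
      by (intro group.inv_equality[OF group_thompson_V]) auto
    then show "inv\<^bsub>thompson_V\<^esub> p \<in> ?H" using b by simp
  next
    fix p q assume "p \<in> ?H" "q \<in> ?H"
    then obtain a b where "a \<in> carrier wr" "b \<in> carrier wr" "p = wreath_action a" "q = wreath_action b"
      by blast
    then show "p \<otimes>\<^bsub>thompson_V\<^esub> q \<in> ?H"
      using mult_wreath_closed wreath_action_mult by (intro image_eqI[of _ _ "a \<otimes>\<^bsub>wr\<^esub> b"]) auto
  qed
  have "wreath_action \<in> iso wr (thompson_V\<lparr>carrier := ?H\<rparr>)"
    by (auto simp: iso_def hom_def wreath_action_mult bij_betw_def inj_on_wreath_action)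
  then show "wr \<cong> thompson_V\<lparr>carrier := ?H\<rparr>" by (rule is_isoI)
qed

end

end

section \<open>Inducing from a subgroup of finite index\<close>

lemma wandering_action_finite_index:
  fixes T :: "('t, 'm) monoid_scheme" (structure)
  assumes "group T" "subgroup H T" "finite (rcosets H)"
    and "wandering_action (T\<lparr>carrier := H\<rparr>) \<phi> u"
  shows "\<exists>\<rho> v. wandering_action T \<rho> v"
proof -
  interpret group T by fact
  interpret sub: subgroup H T by fact
  interpret \<phi>: wandering_action "T\<lparr>carrier := H\<rparr>" \<phi> u by fact
  let ?R = "rcosets H"
  have "?R \<noteq> {}" using sub.subgroup_in_rcosets[OF is_group] by blast
  then obtain n where "card ?R = Suc n"
    using assms(3) by (metis card_eq_0_iff not0_implies_Suc)
  then obtain B where B: "barrier B" "card B = card ?R" using barrier_card_ex by metis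
  then obtain c where c: "bij_betw c ?R B"
    using finite_same_card_bij[of ?R B] assms(3) by (auto simp: barrier_def)
  have "\<exists>a. a \<in> carrier T \<and> H #> a = K" if "K \<in> ?R" for K
    using that by (auto simp: RCOSETS_def)
  then obtain rep where rep_carrier [simp]: "\<And>K. K \<in> ?R \<Longrightarrow> rep K \<in> carrier T"
    and rep: "\<And>K. K \<in> ?R \<Longrightarrow> H #> rep K = K"
    by metis
  have move [simp]: "K #> t \<in> ?R" if "K \<in> ?R" "t \<in> carrier T" for K t
  proof -
    have "K #> t = H #> (rep K \<otimes> t)" using that rep coset_mult_assoc[of H "rep K" t] sub.subset by simp
    then show ?thesis using that rcosetsI[OF sub.subset] by simp
  qed
  have move_assoc: "K #> s #> t = K #> (s \<otimes> t)" if "K \<in> ?R" "s \<in> carrier T" "t \<in> carrier T" for K s t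
    using that coset_mult_assoc sub.rcosets_carrier[OF is_group] by blast
  have move_one: "K #> \<one> = K" if "K \<in> ?R" for K
    using that coset_mult_one sub.rcosets_carrier[OF is_group] by blast
  \<comment> \<open>Right cosets carry a left action of \<open>T\<close> by
    \<open>K #> inv t\<close>. As \<open>rep (K #> inv t)\<close> and
    \<open>rep K \<otimes> inv t\<close> lie in the same coset, their quotient \<open>h t K\<close>
    lies in \<open>H\<close>.\<close>
  define h where "h t K = rep (K #> inv t) \<otimes> t \<otimes> inv (rep K)" for t K
  have h: "h t K \<in> H" if "K \<in> ?R" "t \<in> carrier T" for t K
  proof -
    have "H #> rep (K #> inv t) = H #> rep K #> inv t"
      using that by (simp only: rep move inv_closed)
    also have "\<dots> = H #> (rep K \<otimes> inv t)"
      using that coset_mult_assoc[of H "rep K" "inv t"] sub.subset by simp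
    finally have "H #> rep (K #> inv t) = H #> (rep K \<otimes> inv t)" .
    then have "rep (K #> inv t) \<in> H #> (rep K \<otimes> inv t)"
      using that rcos_self[OF _ assms(2), of "rep (K #> inv t)"] by simp
    then have "rep (K #> inv t) \<otimes> inv (rep K \<otimes> inv t) \<in> H"
      using that sub.rcos_module_imp[OF is_group] by simp
    then show ?thesis using that by (simp add: h_def inv_mult_group m_assoc)
  qed
  \<comment> \<open>The cocycle identity: the middle representative cancels. It makes
    \<open>\<rho>\<close> multiplicative.\<close>
  have h_mult: "h (s \<otimes> t) K = h s (K #> inv t) \<otimes> h t K"
    if "K \<in> ?R" "s \<in> carrier T" "t \<in> carrier T" for s t K
  proof -
    have "inv (rep (K #> inv t)) \<otimes> (rep (K #> inv t) \<otimes> (t \<otimes> inv rep K)) = t \<otimes> inv rep K"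
      using that by (simp add: m_assoc[symmetric])
    then show ?thesis using that by (simp add: h_def inv_mult_group move_assoc m_assoc)
  qed
  have "\<exists>f. prefix_replacement_map f \<and> (\<forall>K\<in>?R. \<forall>x. f (c K @- x) = c (K #> inv t) @- \<phi> (h t K) x)"
    if t: "t \<in> carrier T" for t
  proof (rule prefix_replacement_map_glue[OF B(1) c])
    show "bij_betw (\<lambda>K. K #> inv t) ?R ?R"
      by (rule bij_betw_byWitness[of _ "\<lambda>K. K #> t"]) (use t in \<open>auto simp: move_assoc move_one\<close>)
    show "prefix_replacement_map (\<phi> (h t K))" if "K \<in> ?R" for K
      using \<phi>.prefix_replacement_map_action h that t by simp
  qed
  then obtain \<rho> where V: "\<And>t. t \<in> carrier T \<Longrightarrow> prefix_replacement_map (\<rho> t)"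
    and \<rho>: "\<And>t K x. t \<in> carrier T \<Longrightarrow> K \<in> ?R \<Longrightarrow> \<rho> t (c K @- x) = c (K #> inv t) @- \<phi> (h t K) x"
    by metis
  have cB: "c K \<in> B" if "K \<in> ?R" for K using c that by (auto simp: bij_betw_def)
  have mult: "\<rho> (s \<otimes> t) = \<rho> s \<circ> \<rho> t" if st: "s \<in> carrier T" "t \<in> carrier T" for s t
  proof (rule ext)
    fix z
    obtain w x where "w \<in> B" "z = w @- x" using barrier_cover[OF B(1)] .
    then obtain K where K: "K \<in> ?R" "z = c K @- x" using c by (auto simp: bij_betw_def)
    have "\<phi> (h s (K #> inv t) \<otimes> h t K) = \<phi> (h s (K #> inv t)) \<circ> \<phi> (h t K)"
      using \<phi>.action_mult h K st by simp
    then show "\<rho> (s \<otimes> t) z = (\<rho> s \<circ> \<rho> t) z"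
      using K st by (simp add: \<rho> h_mult move_assoc inv_mult_group)
  qed
  have H: "H \<in> ?R" using sub.subgroup_in_rcosets[OF is_group] .
  \<comment> \<open>Returning to the copy of the cylinder in the cell of \<open>H\<close> forces
    \<open>t\<close> to fix that coset and then, by wandering for \<open>H\<close>, gives
    \<open>h t H = \<one>\<close>. Since \<open>rep H\<close> may differ from \<open>\<one>\<close>,
    this says that a conjugate of \<open>t\<close> is trivial.\<close>
  have "wandering_action T \<rho> (c H @ u)"
  proof unfold_locales
    show "\<rho> \<in> hom T thompson_V" using V mult by (auto simp: hom_def)
  next
    fix t x y assume t: "t \<in> carrier T" and eq: "\<rho> t ((c H @ u) @- x) = (c H @ u) @- y"
    have "c (H #> inv t) @- \<phi> (h t H) (u @- x) = c H @- (u @- y)" using eq t H \<rho> by simp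
    then have "c (H #> inv t) = c H \<and> \<phi> (h t H) (u @- x) = u @- y"
      using t H by (intro barrier_unique[OF B(1)] cB) auto
    then have "H #> inv t = H" "h t H = \<one>"
      using c t H h \<phi>.wandering[of "h t H" x y] by (auto simp: bij_betw_def inj_on_def)
    then have "rep H \<otimes> t \<otimes> inv (rep H) = \<one>" by (simp add: h_def)
    then have "rep H \<otimes> t = rep H"
      using t H by (metis inv_solve_right' l_one m_closed one_closed rep_carrier)
    then show "t = \<one>" using t H by (metis r_cancel_one rep_carrier l_cancel_one)
  qed
  then show ?thesis by blast
qed

section \<open>Ping-pong\<close>

text \<open>
  \<open>drift\<close> maps the complement of \<open>cylinder 00\<close> onto \<open>cylinder 01\<close>, so the
  images of \<open>cylinder 1\<close> under its powers are disjoint.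
\<close>

definition drift :: "bool stream \<Rightarrow> bool stream" where
  "drift s =
     (if shd s then [False, True, False] @- stl s
      else if shd (stl s) then [False, True, True] @- sdrop 2 s
      else if shd (sdrop 2 s) then sdrop 2 s
      else stl s)"

definition drift_inverse :: "bool stream \<Rightarrow> bool stream" where
  "drift_inverse s =
     (if shd s then [False, False] @- s
      else if \<not> shd (stl s) then False ## s
      else if shd (sdrop 2 s) then [False, True] @- sdrop 3 s
      else True ## sdrop 3 s)"

text \<open>
  \<open>pong\<close> maps the complement of \<open>cylinder 10\<close> onto \<open>cylinder 110\<close>.
\<close>

definition pong :: "bool stream \<Rightarrow> bool stream" where
  "pong s =
     (if \<not> shd s then [True, True, False] @- s
      else if shd (stl s) then [True, True, False, True] @- sdrop 2 s
      else if \<not> shd (sdrop 2 s) then False ## sdrop 3 s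
      else if \<not> shd (sdrop 3 s) then [True, False] @- sdrop 4 s
      else [True, True, True] @- sdrop 4 s)"

definition pong_inverse :: "bool stream \<Rightarrow> bool stream" where
  "pong_inverse s =
     (if \<not> shd s then [True, False, False] @- stl s
      else if \<not> shd (stl s) then [True, False, True, False] @- sdrop 2 s
      else if shd (sdrop 2 s) then [True, False, True, True] @- sdrop 3 s
      else if shd (sdrop 3 s) then [True, True] @- sdrop 4 s
      else False ## sdrop 4 s)"

text \<open>No branch of \<open>drift\<close>, \<open>pong\<close> or their inverses looks past the
  fourth letter.\<close>

lemma stream_cases_4:
  obtains a b c d t where "s = a ## b ## c ## d ## t"
  by (metis stream.exhaust)

lemma drift_inverse_cancel: "drift_inverse (drift s) = s" "drift (drift_inverse s) = s"
  by (rule stream_cases_4[of s]; auto simp: drift_def drift_inverse_def eval_nat_numeral)+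

lemma pong_inverse_cancel: "pong_inverse (pong s) = s" "pong (pong_inverse s) = s"
  by (rule stream_cases_4[of s]; auto simp: pong_def pong_inverse_def eval_nat_numeral)+

lemma bij_drift: "bij drift"
  by (rule o_bij[of drift_inverse]) (auto simp: drift_inverse_cancel fun_eq_iff)

lemma bij_pong: "bij pong"
  by (rule o_bij[of pong_inverse]) (auto simp: pong_inverse_cancel fun_eq_iff)

lemma prefix_replacement_mapI_four:
  assumes "bij f"
    and "\<And>a b c d. \<exists>r. \<forall>x. f (a ## b ## c ## d ## x) = r @- x"
  shows "prefix_replacement_map f"
proof (rule prefix_replacement_mapI[OF assms(1) finite_words cylinder_cover_length])
  fix w :: "bool list" assume "w \<in> {w. length w = 4}"
  then obtain a b c d where "w = [a, b, c, d]"
    by (auto simp: length_Suc_conv eval_nat_numeral)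
  then show "\<exists>r. \<forall>x. f (w @- x) = r @- x" using assms(2) by simp
qed

lemma prefix_replacement_map_drift: "prefix_replacement_map drift"
proof (rule prefix_replacement_mapI_four[OF bij_drift])
  fix a b c d
  show "\<exists>r. \<forall>x. drift (a ## b ## c ## d ## x) = r @- x"
    by (rule exI[of _ "if a then [False, True, False, b, c, d] else if b then [False, True, True, c, d]
          else if c then [c, d] else [b, c, d]"])
      (simp add: drift_def eval_nat_numeral)
qed

lemma prefix_replacement_map_pong: "prefix_replacement_map pong"
proof (rule prefix_replacement_mapI_four[OF bij_pong])
  fix a b c d
  show "\<exists>r. \<forall>x. pong (a ## b ## c ## d ## x) = r @- x"
    by (rule exI[of _ "if \<not> a then [True, True, False, a, b, c, d]
          else if b then [True, True, False, True, c, d] else if \<not> c then [False, d]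
          else if \<not> d then [True, False] else [True, True, True]"])
      (simp add: pong_def eval_nat_numeral)
qed

lemma cylinder_Cons [simp]: "s \<in> cylinder (b # w) \<longleftrightarrow> shd s = b \<and> stl s \<in> cylinder w"
  by (cases s) auto

text \<open>Cylinder 01 receives cylinder 1 and is mapped into itself, so positive powers of
  \<open>drift\<close> never bring a point of cylinder 1 back there.\<close>

lemma drift_cylinder: "s \<in> cylinder [True] \<or> s \<in> cylinder [False, True] \<Longrightarrow> drift s \<in> cylinder [False, True]"
  by (rule stream_cases_4[of s]) (auto simp: drift_def eval_nat_numeral)

lemma pong_cylinder: "s \<notin> cylinder [True, False] \<Longrightarrow> pong s \<in> cylinder [True, True, False]"
  by (rule stream_cases_4[of s]) (auto simp: pong_def eval_nat_numeral)

lemma pong_inverse_cylinder: "s \<notin> cylinder [True, True, False] \<Longrightarrow> pong_inverse s \<in> cylinder [True, False]"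
  by (rule stream_cases_4[of s]) (auto simp: pong_inverse_def eval_nat_numeral)

lemma drift_pow_cylinder: "s \<in> cylinder [True] \<Longrightarrow> (drift ^^ Suc n) s \<in> cylinder [False, True]"
  by (induction n) (use drift_cylinder in auto)

lemma inj_drift_pow: "inj (drift ^^ n)"
  using bij_drift by (simp add: bij_is_inj inj_fn)

text \<open>If the exponents differed, cancelling the smaller power would put a point of cylinder 1
  into cylinder 01.\<close>

lemma drift_pow_disjoint:
  assumes "(drift ^^ m) s = (drift ^^ n) t" "s \<in> cylinder [True]" "t \<in> cylinder [True]"
  shows "m = n \<and> s = t"
proof -
  have no: False if "(drift ^^ i) p = (drift ^^ j) q" "i < j" "p \<in> cylinder [True]" "q \<in> cylinder [True]" for i j p q
  proof -
    obtain k where "j = i + Suc k" using \<open>i < j\<close> less_imp_Suc_add by auto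
    then have "(drift ^^ i) p = (drift ^^ i) ((drift ^^ Suc k) q)" using that by (simp only: funpow_add comp_apply)
    then have "p = (drift ^^ Suc k) q" using inj_drift_pow by (rule injD[rotated])
    then have "p \<in> cylinder [False, True]" using drift_pow_cylinder that by blast
    then show False using that by auto
  qed
  have "m = n" using no[OF assms(1)] no[OF assms(1)[symmetric]] assms by (meson linorder_neqE_nat)
  then show ?thesis using assms inj_drift_pow by (auto dest: injD)
qed

lemma drift_pow_inverse_cancel:
  "(drift ^^ n) ((drift_inverse ^^ n) s) = s" "(drift_inverse ^^ n) ((drift ^^ n) s) = s"
  by (induction n arbitrary: s) (simp_all add: funpow_swap1 drift_inverse_cancel)

text \<open>
  The conjugates of \<open>pong\<close> by the powers of \<open>drift\<close> play ping-pong with infinitely many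
  pairs of zones.
\<close>

definition generator :: "nat \<Rightarrow> bool \<Rightarrow> bool stream \<Rightarrow> bool stream" where
  "generator n b = (drift ^^ n) \<circ> (if b then pong else pong_inverse) \<circ> (drift_inverse ^^ n)"

text \<open>\<open>zone n b\<close> attracts under \<open>generator n b\<close> and repels under its
  inverse. For \<open>n = 0\<close> the two zones lie in cylinder 1 and leave out 111, which becomes
  \<open>home\<close>.\<close>

definition zone :: "nat \<Rightarrow> bool \<Rightarrow> bool stream set" where
  "zone n b = (drift ^^ n) ` cylinder (if b then [True, True, False] else [True, False])"

abbreviation home :: "bool stream set" where
  "home \<equiv> cylinder [True, True, True]"

lemma prefix_replacement_map_generator: "prefix_replacement_map (generator n b)"
proof -
  have "inverse_map drift = drift_inverse" "inverse_map pong = pong_inverse"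
    by (auto intro!: inv_equality simp: drift_inverse_cancel pong_inverse_cancel)
  then have "prefix_replacement_map drift_inverse" "prefix_replacement_map pong_inverse"
    using prefix_replacement_map_inv prefix_replacement_map_drift prefix_replacement_map_pong
    by metis+
  then show ?thesis
    unfolding generator_def
    by (auto intro!: prefix_replacement_map_comp prefix_replacement_map_funpow
        prefix_replacement_map_drift prefix_replacement_map_pong)
qed

lemma generator_cancel: "generator n (\<not> b) \<circ> generator n b = id"
  by (auto simp: generator_def fun_eq_iff drift_pow_inverse_cancel pong_inverse_cancel)

lemma zone_disjoint:
  assumes "s \<in> zone m b" "s \<in> zone n c"
  shows "m = n \<and> b = c"
proof -
  obtain p where p: "s = (drift ^^ m) p" "p \<in> cylinder (if b then [True, True, False] else [True, False])"
    using assms(1) unfolding zone_def by blast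
  obtain q where q: "s = (drift ^^ n) q" "q \<in> cylinder (if c then [True, True, False] else [True, False])"
    using assms(2) unfolding zone_def by blast
  have "m = n \<and> p = q"
    using p q by (intro drift_pow_disjoint) (auto split: if_splits)
  then show ?thesis using p(2) q(2) by (auto split: if_splits)
qed

lemma home_zone_disjoint:
  assumes "s \<in> home"
  shows "s \<notin> zone n b"
proof
  assume "s \<in> zone n b"
  then obtain p where p: "s = (drift ^^ n) p" "p \<in> cylinder (if b then [True, True, False] else [True, False])"
    unfolding zone_def by blast
  \<comment> \<open>As part of cylinder 1, \<open>home\<close> counts as an image under power 0, so
    \<open>drift_pow_disjoint\<close> excludes \<open>n > 0\<close>; for \<open>n = 0\<close>, 111
    is disjoint from 110 and 10.\<close>
  have "(drift ^^ 0) s = (drift ^^ n) p" using p by simp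
  then have "s = p" using drift_pow_disjoint[of 0 s n p] p(2) assms by (auto split: if_splits)
  then show False using p(2) assms by (auto split: if_splits)
qed

lemma generator_zone:
  assumes "s \<notin> zone n (\<not> b)"
  shows "generator n b s \<in> zone n b"
proof -
  let ?p = "(drift_inverse ^^ n) s"
  have "?p \<notin> cylinder (if \<not> b then [True, True, False] else [True, False])"
    using assms drift_pow_inverse_cancel(1)[of n s] unfolding zone_def by (metis imageI)
  then show ?thesis
    using pong_cylinder pong_inverse_cylinder unfolding zone_def generator_def
    by (cases b) auto
qed

section \<open>Free groups of countable rank\<close>

definition word_map :: "('a \<Rightarrow> nat) \<Rightarrow> ('a \<times> bool) list \<Rightarrow> bool stream \<Rightarrow> bool stream" where
  "word_map e w = foldr (\<lambda>(s, b) f. generator (e s) b \<circ> f) w id"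

lemma word_map_Nil [simp]: "word_map e [] = id"
  by (simp add: word_map_def)

lemma word_map_Cons [simp]: "word_map e ((s, b) # w) = generator (e s) b \<circ> word_map e w"
  by (simp add: word_map_def)

lemma word_map_append: "word_map e (v @ w) = word_map e v \<circ> word_map e w"
  by (induction v) (auto simp: comp_assoc)

lemma prefix_replacement_map_word_map: "prefix_replacement_map (word_map e w)"
proof (induction w)
  case Nil
  then show ?case using prefix_replacement_map_id by (simp only: word_map_Nil)
next
  case (Cons l w)
  then show ?case
    using prefix_replacement_map_comp[OF prefix_replacement_map_generator]
    by (cases l) (simp only: word_map_Cons)
qed

lemma Cons_in_reduced_words:
  "(s, b) # w \<in> reduced_words S \<longleftrightarrow>
     s \<in> S \<and> w \<in> reduced_words S \<and> (\<forall>v. w \<noteq> (s, \<not> b) # v)"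
  by (cases w) (auto simp: reduced_words_def)

text \<open>Ping-pong from the inside out: the rightmost letter acts first and moves a point of
  \<open>home\<close>, which meets no zone, into its own zone. Each further letter is not inverse to
  its right neighbour, so the point is outside its repelling zone.\<close>

lemma word_map_zone:
  assumes "inj_on e S" "(s, b) # w \<in> reduced_words S" "z \<in> home"
  shows "word_map e ((s, b) # w) z \<in> zone (e s) b"
  using assms(2)
proof (induction w arbitrary: s b)
  case Nil
  then show ?case using generator_zone home_zone_disjoint[OF assms(3)] by simp
next
  case (Cons l w)
  obtain t c where l: "l = (t, c)" by fastforce
  have red: "(t, c) # w \<in> reduced_words S" "s \<in> S" "t \<in> S" "(t, c) \<noteq> (s, \<not> b)"
    using Cons.prems l by (auto simp: Cons_in_reduced_words)
  have "word_map e ((t, c) # w) z \<in> zone (e t) c" by (rule Cons.IH[OF red(1)])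
  moreover have "(e t, c) \<noteq> (e s, \<not> b)" using red assms(1) by (auto simp: inj_on_def)
  ultimately have "word_map e ((t, c) # w) z \<notin> zone (e s) (\<not> b)" using zone_disjoint by blast
  then show ?case using l generator_zone by simp
qed

section \<open>Values of words and free reduction\<close>

lemma word_value_Cons: "word_value F (l # w) = letter_value F l \<otimes>\<^bsub>F\<^esub> word_value F w"
  by (simp add: word_value_def)

lemma word_value_Nil: "word_value F [] = \<one>\<^bsub>F\<^esub>"
  by (simp add: word_value_def)

context group
begin

lemma letter_value_closed: "S \<subseteq> carrier G \<Longrightarrow> l \<in> S \<times> UNIV \<Longrightarrow> letter_value G l \<in> carrier G"
  by (auto simp: letter_value_def)

lemma word_value_closed: "S \<subseteq> carrier G \<Longrightarrow> w \<in> lists (S \<times> UNIV) \<Longrightarrow> word_value G w \<in> carrier G"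
  by (induction w) (auto simp: word_value_Cons word_value_Nil letter_value_closed)

lemma word_value_append:
  assumes "S \<subseteq> carrier G" "v \<in> lists (S \<times> UNIV)" "w \<in> lists (S \<times> UNIV)"
  shows "word_value G (v @ w) = word_value G v \<otimes> word_value G w"
  using assms(2)
proof (induction v)
  case Nil
  then show ?case using word_value_closed[OF assms(1,3)] by (simp add: word_value_Nil)
next
  case (Cons l v)
  have "letter_value G l \<in> carrier G" "word_value G v \<in> carrier G" "word_value G w \<in> carrier G"
    using Cons.hyps letter_value_closed[OF assms(1)] word_value_closed[OF assms(1)] assms(3) by blast+
  then show ?case using Cons.IH by (simp add: word_value_Cons m_assoc)
qed

text \<open>Free reduction preserves the group value and the map at once. When distinct reduced
  words have distinct values, the map of a word therefore depends only on its value.\<close>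

lemma reduce_word:
  assumes "S \<subseteq> carrier G" "w \<in> lists (S \<times> UNIV)"
  shows "\<exists>v\<in>reduced_words S. word_value G v = word_value G w \<and> word_map e v = word_map e w"
  using assms(2)
proof (induction w)
  case Nil
  show ?case by (rule bexI[of _ "[]"]) (auto simp: reduced_words_def)
next
  case (Cons l w)
  obtain s b where l: "l = (s, b)" "s \<in> S" using Cons.hyps by fastforce
  obtain v where v: "v \<in> reduced_words S" "word_value G v = word_value G w" "word_map e v = word_map e w"
    using Cons.IH by blast
  show ?case
  \<comment> \<open>A letter put before a reduced word leaves it reduced unless it meets its own
    inverse; then both cancel and a reduced word remains.\<close>
  proof (cases "\<exists>v'. v = (s, \<not> b) # v'")
    case False
    then show ?thesis
      using l v by (intro bexI[of _ "l # v"]) (auto simp: word_value_Cons Cons_in_reduced_words)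
  next
    case True
    then obtain v' where v': "v = (s, \<not> b) # v'" by blast
    then have red: "v' \<in> reduced_words S" using v by (simp add: Cons_in_reduced_words)
    then have closed: "word_value G v' \<in> carrier G" "s \<in> carrier G"
      using word_value_closed[OF assms(1)] l assms(1) by (auto simp: reduced_words_def)
    have "letter_value G (s, b) \<otimes> letter_value G (s, \<not> b) = \<one>"
      using closed by (simp add: letter_value_def)
    then have "letter_value G (s, b) \<otimes> (letter_value G (s, \<not> b) \<otimes> word_value G v') = word_value G v'"
      using closed by (simp add: letter_value_def m_assoc[symmetric])
    then have "word_value G (l # w) = word_value G v'"
      using l v(2) v' by (simp add: word_value_Cons flip: v(2))
    moreover have "word_map e (l # w) = word_map e v'"
    proof -
      have "word_map e (l # w) = generator (e s) b \<circ> generator (e s) (\<not> b) \<circ> word_map e v'"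
        using l v' by (simp add: comp_assoc flip: v(3))
      then show ?thesis using generator_cancel[of "e s" "\<not> b"] by simp
    qed
    ultimately show ?thesis using red by metis
  qed
qed

end

lemma wandering_action_free_group:
  fixes F :: "('t, 'm) monoid_scheme" (structure)
  assumes "free_group F" "countable (carrier F)"
  shows "\<exists>\<phi> u. wandering_action F \<phi> u"
proof -
  interpret group F using assms(1) by (simp add: free_group_def)
  obtain S where S: "S \<subseteq> carrier F" and bij: "bij_betw (word_value F) (reduced_words S) (carrier F)"
    using assms(1) by (auto simp: free_group_def)
  define e where "e = to_nat_on S"
  have e: "inj_on e S" using S assms(2) countable_subset unfolding e_def by blast
  define word where "word = inv_into (reduced_words S) (word_value F)"
  have word: "word g \<in> reduced_words S" "word_value F (word g) = g" if "g \<in> carrier F" for g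
    using that bij by (auto simp: word_def bij_betw_def inv_into_into f_inv_into_f)
  have word_eq: "word (word_value F v) = v" if "v \<in> reduced_words S" for v
    using that bij by (simp add: word_def bij_betw_def)
  define \<phi> where "\<phi> g = word_map e (word g)" for g
  \<comment> \<open>\<open>\<phi>\<close> is defined through reduced words, but a product is
    computed by concatenation, which may not be reduced; hence this formula for all words.\<close>
  have \<phi>: "\<phi> (word_value F w) = word_map e w" if "w \<in> lists (S \<times> UNIV)" for w
    using reduce_word[OF S that, of e] word_eq unfolding \<phi>_def by metis
  have words: "word g \<in> lists (S \<times> UNIV)" if "g \<in> carrier F" for g
    using word[OF that] by (simp add: reduced_words_def)
  have mult: "\<phi> (g \<otimes> h) = \<phi> g \<circ> \<phi> h" if "g \<in> carrier F" "h \<in> carrier F" for g h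
  proof -
    have "g \<otimes> h = word_value F (word g @ word h)"
      using that words word word_value_append[OF S] by simp
    then have "\<phi> (g \<otimes> h) = word_map e (word g @ word h)"
      using \<phi>[of "word g @ word h"] that words by simp
    then show ?thesis by (simp add: \<phi>_def word_map_append)
  qed
  have "wandering_action F \<phi> [True, True, True]"
  proof unfold_locales
    show "\<phi> \<in> hom F thompson_V"
      using mult by (auto simp: hom_def \<phi>_def prefix_replacement_map_word_map)
  next
    fix g x y assume g: "g \<in> carrier F" and eq: "\<phi> g ([True, True, True] @- x) = [True, True, True] @- y"
    \<comment> \<open>A nonempty reduced word would send \<open>home\<close> into a zone, and zones
      miss \<open>home\<close>.\<close>
    have "word g = []"
    proof (rule ccontr)
      assume "word g \<noteq> []"
      then obtain s b w where w: "word g = (s, b) # w" by (metis list.exhaust surj_pair)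
      have "word_map e ((s, b) # w) ([True, True, True] @- x) \<in> zone (e s) b"
        using word(1)[OF g] w by (intro word_map_zone[OF e]) auto
      then have "[True, True, True] @- y \<in> zone (e s) b" using eq w by (simp only: \<phi>_def)
      then show False using home_zone_disjoint by blast
    qed
    then show "g = \<one>" using word(2)[OF g] by (simp add: word_value_Nil)
  qed
  then show ?thesis by blast
qed

theorem theorem4:
  fixes G :: "(bool stream \<Rightarrow> bool stream) set"
    and T :: "('t, 'm) monoid_scheme"
  assumes "subgroup G thompson_V"
    and "group T"
    and "countable (carrier T)"
    and "virtually_free T"
  shows "\<exists>H. subgroup H thompson_V \<and>
           wreath_product (thompson_V\<lparr>carrier := G\<rparr>) T \<cong> thompson_V\<lparr>carrier := H\<rparr>"
proof -
  obtain H where H: "subgroup H T" "free_group (T\<lparr>carrier := H\<rparr>)" "finite (rcosets\<^bsub>T\<^esub> H)"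
    using assms(4) by (auto simp: virtually_free_def)
  have "countable (carrier (T\<lparr>carrier := H\<rparr>))"
    using subgroup.subset[OF H(1)] assms(3) countable_subset by auto
  then obtain \<phi> u where "wandering_action (T\<lparr>carrier := H\<rparr>) \<phi> u"
    using wandering_action_free_group[OF H(2)] by blast
  then obtain \<rho> v where "wandering_action T \<rho> v"
    using wandering_action_finite_index[OF assms(2) H(1,3)] by blast
  then show ?thesis using wandering_action.wreath_product_embeds assms(1) by blast
qed

end
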